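(* Let $\Delta(\mathbb G_d)=2d-x_1-x_1^{-1}-\cdots-x_d-x_d^{-1}$. Then (1) for every $d\ge1$, $m(\Delta(\mathbb G_d))\le\log 2d$; and (2) $\lim_{d\to\infty}\big(m(\Delta(\mathbb G_d))-\log 2d\big)=0$.
   Context: For a nonzero Laurent polynomial $f\in\mathbb Z[x_1^{\pm1},\ldots,x_d^{\pm1}]$, the logarithmic Mahler measure is $m(f)=\int_0^1\cdots\int_0^1\log|f(e^{2\pi i\theta_1},\ldots,e^{2\pi i\theta_d})|\,d\theta_1\cdots d\theta_d$. $\Delta(\mathbb G_d)$ is the Laplacian polynomial of the $d$-dimensional grid graph $\mathbb G_d$ (vertex set $\mathbb Z^d$, edges between vertices differing by $\pm1$ in exactly one coordinate). *)

theory Defs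
  imports "HOL-Analysis.Analysis" "HOL-Library.Poly_Mapping"
begin

text \<open>
  Integer Laurent polynomials form the group ring of the exponent group: a polynomial maps each
  exponent vector (finitely supported, \<open>nat \<Rightarrow>\<^sub>0 int\<close>) to its coefficient, and multiplication
  on \<open>\<Rightarrow>\<^sub>0\<close> is convolution. Variables are numbered from 0, so the ring in \<open>d\<close> variables
  consists of the polynomials whose exponent vectors are supported in \<open>{..<d}\<close>.
\<close>

type_synonym laurent_poly = "(nat \<Rightarrow>\<^sub>0 int) \<Rightarrow>\<^sub>0 int"

definition laurent_var :: "nat \<Rightarrow> laurent_poly" where
  "laurent_var i = Poly_Mapping.single (Poly_Mapping.single i 1) 1"

definition laurent_var_inv :: "nat \<Rightarrow> laurent_poly" where
  "laurent_var_inv i = Poly_Mapping.single (Poly_Mapping.single i (- 1)) 1"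

lemma laurent_var_mult_inv: "laurent_var i * laurent_var_inv i = 1"
  by (simp add: laurent_var_def laurent_var_inv_def mult_single flip: single_add)

definition laurent_eval :: "laurent_poly \<Rightarrow> (nat \<Rightarrow> complex) \<Rightarrow> complex" where
  "laurent_eval f z =
    (\<Sum>a\<in>Poly_Mapping.keys f. of_int (Poly_Mapping.lookup f a) *
      (\<Prod>i\<in>Poly_Mapping.keys a. z i powi Poly_Mapping.lookup a i))"

text \<open>
  The logarithmic Mahler measure of a nonzero Laurent polynomial in the variables \<open>0, ..., d - 1\<close>,
  as a Lebesgue integral over the unit cube. Where the polynomial vanishes on the torus (a null set),
  the convention \<open>ln 0 = 0\<close> applies.
\<close>

definition mahler_measure :: "nat \<Rightarrow> laurent_poly \<Rightarrow> real" where
  "mahler_measure d f =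
    (\<integral>\<theta>. ln (cmod (laurent_eval f (\<lambda>j. exp (2 * of_real pi * \<i> * of_real (\<theta> j)))))
      \<partial>(\<Pi>\<^sub>M j\<in>{..<d}. restrict_space lborel {0..1 :: real}))"

definition grid_laplacian :: "nat \<Rightarrow> laurent_poly" where
  "grid_laplacian d = 2 * of_nat d - (\<Sum>i<d. laurent_var i + laurent_var_inv i)"

text \<open>
  \<open>grid_adj d\<close> is adjacency in the grid graph, whose vertices are the integer vectors supported in
  \<open>{..<d}\<close>. The coefficients of \<open>grid_laplacian d\<close> are the entries of the graph Laplacian (degree
  \<open>2 * d\<close> on the diagonal, minus adjacency off it) in the row of the origin.
\<close>

definition grid_adj :: "nat \<Rightarrow> (nat \<Rightarrow>\<^sub>0 int) \<Rightarrow> (nat \<Rightarrow>\<^sub>0 int) \<Rightarrow> bool" where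
  "grid_adj d u v \<longleftrightarrow> (\<exists>i<d. \<bar>Poly_Mapping.lookup u i - Poly_Mapping.lookup v i\<bar> = 1 \<and>
     (\<forall>j. j \<noteq> i \<longrightarrow> Poly_Mapping.lookup u j = Poly_Mapping.lookup v j))"

lemma lookup_grid_laplacian:
  "Poly_Mapping.lookup (grid_laplacian d) v =
    (if v = 0 then 2 * int d else if grid_adj d 0 v then - 1 else 0)"
proof -
  have two: "(2 * of_nat d :: laurent_poly) = Poly_Mapping.single 0 (2 * int d)"
    by (metis of_nat_mult of_nat_numeral single_of_nat)
  let ?k = "\<lambda>i. (if v = Poly_Mapping.single i 1 then 1 else 0) +
    (if v = Poly_Mapping.single i (- 1) then 1 else (0 :: int))"
  have "Poly_Mapping.lookup (laurent_var i + laurent_var_inv i) v = ?k i" for i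
    unfolding laurent_var_def laurent_var_inv_def lookup_add lookup_single when_def
    by (simp only: eq_commute[of v])
  then have coeff: "Poly_Mapping.lookup (grid_laplacian d) v =
      (if v = 0 then 2 * int d else 0) - (\<Sum>i<d. ?k i)"
    unfolding grid_laplacian_def two lookup_minus lookup_sum lookup_single when_def
    by (simp only: eq_commute[of v])
  have sgl: "v = Poly_Mapping.single i c \<longleftrightarrow>
      Poly_Mapping.lookup v i = c \<and> (\<forall>j. j \<noteq> i \<longrightarrow> Poly_Mapping.lookup v j = 0)" for i c
    unfolding poly_mapping_eq_iff fun_eq_iff lookup_single when_def by metis
  have unit: "\<bar>0 - m\<bar> = 1 \<longleftrightarrow> m = 1 \<or> m = - 1" for m :: int
    by arith
  have adj: "grid_adj d 0 v \<longleftrightarrow>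
      (\<exists>i<d. v = Poly_Mapping.single i 1 \<or> v = Poly_Mapping.single i (- 1))"
    unfolding grid_adj_def sgl lookup_zero unit eq_commute[of "0 :: int"] by blast
  show ?thesis
  proof (cases "grid_adj d 0 v")
    case True
    then obtain i c where i: "i < d" "v = Poly_Mapping.single i c" "c = 1 \<or> c = - 1"
      unfolding adj by blast
    have v: "Poly_Mapping.lookup v i = c" "\<And>j. j \<noteq> i \<Longrightarrow> Poly_Mapping.lookup v j = 0"
      using i(2) sgl by auto
    have nz: "v \<noteq> 0"
      using v(1) i(3) by auto
    have "?k j = (if j = i then 1 else 0)" for j
    proof (cases "j = i")
      case True
      then show ?thesis using v i(3) unfolding sgl by auto
    next
      case False
      then have "Poly_Mapping.lookup v j = 0" by (rule v(2))
      then show ?thesis using False unfolding sgl by simp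
    qed
    then have "(\<Sum>j<d. ?k j) = (\<Sum>j<d. if j = i then 1 else 0)"
      by (simp only:)
    also have "\<dots> = 1"
      using i(1) by simp
    finally show ?thesis
      using nz True coeff by presburger
  next
    case False
    then have zero: "(\<Sum>j<d. ?k j) = 0"
      unfolding adj by (intro sum.neutral) simp
    then show ?thesis
      unfolding coeff zero using False by (simp only: diff_zero if_False)
  qed
qed

end

theory Submission
  imports Defs "HOL-Probability.Probability" "HOL-Real_Asymp.Real_Asymp"
begin

text \<open>
  On the torus the polynomial equals \<open>2 * d * (1 - X)\<close>, where \<open>X\<close> is the mean of \<open>d\<close> independent
  copies of \<open>cos (2 * pi * t)\<close>, so the difference of the Mahler measure and \<open>ln (2 * d)\<close> is the
  expectation of \<open>ln (1 - X)\<close>. It is at most the expectation of \<open>- X\<close>, which is 0. For the lower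
  bound, \<open>- ln (1 - X) - X\<close> is at most a multiple of \<open>X\<^sup>2\<close>, whose expectation is at most \<open>1 / d\<close>,
  unless \<open>X\<close> is near 1. There convexity of \<open>- ln\<close> bounds \<open>(ln (1 - X))\<^sup>2\<close> by the mean of the
  \<open>(ln (1 - cos (2 * pi * t\<^sub>i)))\<^sup>2\<close>, whose expectation is finite and independent of \<open>d\<close>.
  Balancing the two contributions gives an error of order \<open>1 / sqrt d\<close>.
\<close>

section \<open>Evaluation of the grid Laplacian on the torus\<close>

text \<open>The added exponents have coefficient 0. Summing over a common index set makes evaluation
  additive even when cancellation shrinks the support of a sum.\<close>

lemma laurent_eval_superset:
  assumes "finite S" "Poly_Mapping.keys f \<subseteq> S"
  shows "laurent_eval f z = (\<Sum>a\<in>S. of_int (Poly_Mapping.lookup f a) *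
      (\<Prod>i\<in>Poly_Mapping.keys a. z i powi Poly_Mapping.lookup a i))"
  unfolding laurent_eval_def
  by (rule sum.mono_neutral_left) (use assms in \<open>auto simp: in_keys_iff\<close>)

lemma laurent_eval_add: "laurent_eval (f + g) z = laurent_eval f z + laurent_eval g z"
proof -
  let ?S = "Poly_Mapping.keys f \<union> Poly_Mapping.keys g"
  have "Poly_Mapping.keys (f + g) \<subseteq> ?S" by (rule keys_add)
  then show ?thesis
    by (simp add: laurent_eval_superset[of ?S] lookup_add algebra_simps sum.distrib)
qed

lemma laurent_eval_diff: "laurent_eval (f - g) z = laurent_eval f z - laurent_eval g z"
  using laurent_eval_add[of "f - g" g z] by simp

lemma laurent_eval_sum: "laurent_eval (\<Sum>i\<in>I. f i) z = (\<Sum>i\<in>I. laurent_eval (f i) z)"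
proof (induction I rule: infinite_finite_induct)
  case (insert i I)
  then show ?case by (simp add: laurent_eval_add)
qed (simp_all add: laurent_eval_def)

lemma laurent_eval_single:
  "laurent_eval (Poly_Mapping.single a c) z =
    of_int c * (\<Prod>i\<in>Poly_Mapping.keys a. z i powi Poly_Mapping.lookup a i)"
  by (subst laurent_eval_superset[of "{a}"]) (auto simp: lookup_single)

lemma laurent_eval_grid_laplacian:
  "laurent_eval (grid_laplacian d) z = 2 * of_nat d - (\<Sum>i<d. z i + inverse (z i))"
proof -
  have two: "(2 * of_nat d :: laurent_poly) = Poly_Mapping.single 0 (2 * int d)"
    by (metis of_nat_mult of_nat_numeral single_of_nat)
  show ?thesis
    unfolding grid_laplacian_def two laurent_eval_diff laurent_eval_sum laurent_eval_add
      laurent_var_def laurent_var_inv_def laurent_eval_single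
    by (simp add: power_int_minus)
qed

definition cos_mean :: "nat \<Rightarrow> (nat \<Rightarrow> real) \<Rightarrow> real" where
  "cos_mean d \<theta> = (\<Sum>i<d. cos (2 * pi * \<theta> i)) / real d"

lemma cos_mean_le_1: "cos_mean d \<theta> \<le> 1"
proof -
  have "(\<Sum>i<d. cos (2 * pi * \<theta> i)) \<le> (\<Sum>i<d. 1)" by (intro sum_mono) simp
  then show ?thesis by (cases "d = 0") (auto simp: cos_mean_def field_simps)
qed

lemma cmod_laurent_eval_grid_laplacian:
  assumes "d \<ge> 1"
  shows "cmod (laurent_eval (grid_laplacian d) (\<lambda>j. exp (2 * of_real pi * \<i> * of_real (\<theta> j)))) =
    2 * real d * (1 - cos_mean d \<theta>)"
proof -
  have cis: "exp (2 * of_real pi * \<i> * of_real t) = cis (2 * pi * t)" for t :: real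
    by (simp add: cis_conv_exp mult_ac)
  have "laurent_eval (grid_laplacian d) (\<lambda>j. exp (2 * of_real pi * \<i> * of_real (\<theta> j))) =
      2 * of_nat d - (\<Sum>i<d. cis (2 * pi * \<theta> i) + inverse (cis (2 * pi * \<theta> i)))"
    unfolding laurent_eval_grid_laplacian cis ..
  \<comment> \<open>On the unit circle the inverse is the conjugate, so each pair of variables
    contributes twice a cosine and the value is real.\<close>
  also have "\<dots> = 2 * of_nat d - (\<Sum>i<d. of_real (2 * cos (2 * pi * \<theta> i)))"
    by (intro arg_cong2[where f = minus] refl sum.cong) (auto simp: complex_eq_iff)
  also have "\<dots> = of_real (2 * real d * (1 - cos_mean d \<theta>))"
    using assms by (simp add: cos_mean_def field_simps flip: sum_distrib_left)
  \<comment> \<open>The mean is at most 1, so the real value is nonnegative and equals its own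
    modulus.\<close>
  finally show ?thesis
    using cos_mean_le_1[of d \<theta>] by (simp only: norm_of_real) simp
qed

section \<open>Square-integrability of the logarithm in one variable\<close>

abbreviation unit_lborel :: "real measure" where
  "unit_lborel \<equiv> restrict_space lborel {0..1}"

lemma prob_space_unit_lborel: "prob_space unit_lborel"
  by (rule prob_space_restrict_space) auto

lemma AE_unit_lborel_interior: "AE t in unit_lborel. 0 < t \<and> t < 1"
proof -
  have "AE t in lborel. t \<noteq> (0 :: real)" "AE t in lborel. t \<noteq> (1 :: real)"
    by (rule AE_lborel_singleton)+
  then show ?thesis
    by (subst AE_restrict_space_iff) auto
qed

lemma cos_2pi_less_1:
  fixes t :: real
  assumes "0 < t" "t < 1"
  shows "cos (2 * pi * t) < 1"
proof -
  have "sin (pi * t) > 0" using assms by (intro sin_gt_zero) auto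
  then show ?thesis using cos_double_sin[of "pi * t"] by (simp add: mult_ac)
qed

lemma sin_ge_half:
  fixes x :: real
  assumes "0 \<le> x" "x \<le> pi / 2"
  shows "x / 2 \<le> sin x"
proof -
  have "\<bar>sin x - (\<Sum>m<3. sin_coeff m * x ^ m)\<bar> \<le> inverse (fact 3) * \<bar>x\<bar> ^ 3"
    by (rule Maclaurin_sin_bound)
  then have "\<bar>sin x - x\<bar> \<le> x ^ 3 / 6"
    using assms by (simp add: eval_nat_numeral sin_coeff_def divide_simps)
  \<comment> \<open>This makes the Taylor error \<open>x ^ 3 / 6\<close> at most
    \<open>x / 2\<close>. It holds since \<pi>/2 is below 1.7 and 1.7 squared is 2.89.\<close>
  moreover have "x ^ 3 \<le> 3 * x"
  proof -
    have "x \<le> 17 / 10" using assms pi_less_4 pi_approx by simp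
    then have "x * x \<le> (17 / 10) * (17 / 10)" using assms by (intro mult_mono) auto
    then have "x * (x * x) \<le> x * 3" using assms by (intro mult_left_mono) auto
    then show ?thesis by (simp add: power3_eq_cube mult_ac)
  qed
  ultimately show ?thesis by linarith
qed

text \<open>By the half-angle formula the left side of the gap is governed by the square of
  \<open>sin (pi * t)\<close>. The quadratic order of vanishing at 0 is what turns the logarithmic
  singularity into an integrable power of \<open>t\<close>.\<close>

lemma one_minus_cos_2pi_ge:
  fixes t :: real
  assumes "0 \<le> t" "t \<le> 1 / 2"
  shows "t\<^sup>2 \<le> 1 - cos (2 * pi * t)"
proof -
  have "t \<le> pi * t / 2" using assms pi_ge_two mult_right_mono[of 2 pi t] by simp
  also have "\<dots> \<le> sin (pi * t)" using assms by (intro sin_ge_half) (auto simp: field_simps)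
  finally have "t\<^sup>2 \<le> (sin (pi * t))\<^sup>2" using assms by (intro power_mono)
  moreover have "1 - cos (2 * pi * t) = 2 * (sin (pi * t))\<^sup>2"
    using cos_double_sin[of "pi * t"] by (simp add: mult_ac)
  ultimately show ?thesis using zero_le_power2[of "sin (pi * t)"] by linarith
qed

text \<open>The exponent is small enough that inserting y \<ge> t^2 leaves the power -1/2 of t,
  which is integrable at 0. The constant is 8 squared, from writing \<open>- ln y\<close> as 8 times
  the logarithm of \<open>y powr (- 1 / 8)\<close>.\<close>

lemma ln_squared_le_powr:
  fixes y :: real
  assumes "0 < y" "y \<le> 2"
  shows "(ln y)\<^sup>2 \<le> 64 * y powr (- 1 / 4)"
proof (cases "y \<le> 1")
  case True
  have "- ln y = 8 * ln (y powr (- 1 / 8))" using assms by (simp add: ln_powr)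
  also have "\<dots> \<le> 8 * y powr (- 1 / 8)"
    using ln_le_minus_one[of "y powr (- 1 / 8)"] assms by simp
  finally have "(- ln y)\<^sup>2 \<le> (8 * y powr (- 1 / 8))\<^sup>2"
    using True assms by (intro power_mono) auto
  also have "\<dots> = 64 * y powr (- 1 / 4)"
    by (simp add: power2_eq_square flip: powr_add)
  finally show ?thesis by simp
next
  case False
  have "ln y \<le> 1" using ln_le_minus_one[of y] assms by simp
  then have "(ln y)\<^sup>2 \<le> 1\<^sup>2" using False by (intro power_mono) auto
  moreover have "2 powr (-1) \<le> (2 :: real) powr (- 1 / 4)" by (rule powr_mono) auto
  moreover have "(2 :: real) powr (- 1 / 4) \<le> y powr (- 1 / 4)"
    using assms by (intro powr_mono2') auto
  ultimately show ?thesis by (simp add: powr_minus)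
qed

text \<open>The symmetry t \<rightarrow> 1 - t reduces the claim to t \<le> 1/2. Adding the powers
  for both endpoints gives a single dominating function on the whole interval.\<close>

lemma ln_one_minus_cos_squared_le:
  fixes t :: real
  assumes "0 < t" "t < 1"
  shows "(ln (1 - cos (2 * pi * t)))\<^sup>2 \<le> 64 * (t powr (- 1 / 2) + (1 - t) powr (- 1 / 2))"
proof -
  have *: "(ln (1 - cos (2 * pi * s)))\<^sup>2 \<le> 64 * s powr (- 1 / 2)"
    if s: "0 < s" "s \<le> 1 / 2" for s :: real
  proof -
    let ?y = "1 - cos (2 * pi * s)"
    have y: "0 < ?y" "?y \<le> 2"
      using cos_2pi_less_1[of s] s cos_ge_minus_one[of "2 * pi * s"] by auto
    have "?y powr (- 1 / 4) \<le> (s\<^sup>2) powr (- 1 / 4)"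
      using one_minus_cos_2pi_ge[of s] s by (intro powr_mono2') auto
    also have "\<dots> = s powr (- 1 / 2)"
      using s by (simp add: powr_powr flip: powr_numeral)
    finally show ?thesis using ln_squared_le_powr[OF y] by linarith
  qed
  show ?thesis
  proof (cases "t \<le> 1 / 2")
    case True
    then show ?thesis using *[of t] assms powr_ge_zero[of "1 - t" "- 1 / 2"] by argo
  next
    case False
    have "cos (2 * pi * (1 - t)) = cos (2 * pi * t)"
      by (simp add: algebra_simps cos_diff)
    then have "(ln (1 - cos (2 * pi * t)))\<^sup>2 \<le> 64 * (1 - t) powr (- 1 / 2)"
      using *[of "1 - t"] False assms by simp
    then show ?thesis using powr_ge_zero[of t "- 1 / 2"] by argo
  qed
qed

lemma integrable_ln_one_minus_cos_squared:
  "integrable unit_lborel (\<lambda>t. (ln (1 - cos (2 * pi * t)))\<^sup>2)"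
proof (rule Bochner_Integration.integrable_bound)
  have "(\<lambda>t. t powr (- 1 / 2)) absolutely_integrable_on {0..1 :: real}"
    by (subst absolutely_integrable_on_iff_nonneg) (auto intro!: integrable_on_powr_from_0)
  \<comment> \<open>Absolute integrability refers to the completed measure, hence the passage back
    to \<open>lborel\<close>.\<close>
  then have 1: "integrable lborel (\<lambda>t :: real. indicator {0..1} t *\<^sub>R t powr (- 1 / 2))"
    unfolding set_integrable_def by (subst (asm) integrable_completion) auto
  \<comment> \<open>Reflection of the previous function about 1/2, written as an affine
    substitution.\<close>
  have "integrable lborel (\<lambda>t :: real. indicator {0..1} (1 + (-1) * t) *\<^sub>R (1 + (-1) * t) powr (- 1 / 2))"
    by (rule lborel_integrable_real_affine[OF 1]) simp
  moreover have "indicator {0..1} (1 + (-1) * t) = (indicator {0..1} t :: real)" for t :: real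
    by (auto simp: indicator_def)
  ultimately have 2: "integrable lborel (\<lambda>t :: real. indicator {0..1} t *\<^sub>R (1 - t) powr (- 1 / 2))"
    by simp
  show "integrable unit_lborel (\<lambda>t. 64 * (t powr (- 1 / 2) + (1 - t) powr (- 1 / 2)))"
    using 1 2 by (auto intro!: integrable_mult_right Bochner_Integration.integrable_add simp: integrable_restrict_space)
  show "AE t in unit_lborel. norm ((ln (1 - cos (2 * pi * t)))\<^sup>2) \<le>
      norm (64 * (t powr (- 1 / 2) + (1 - t) powr (- 1 / 2)))"
    using AE_unit_lborel_interior
    by eventually_elim (use ln_one_minus_cos_squared_le in force)
qed (auto intro!: measurable_restrict_space1)

lemma integral_cos_2pi: "(\<integral>t. cos (2 * pi * t) \<partial>unit_lborel) = 0"
proof -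
  have "((\<lambda>t. cos (2 * pi * t)) has_integral
      (sin (2 * pi * 1) / (2 * pi) - sin (2 * pi * 0) / (2 * pi))) {0..1}"
    by (rule fundamental_theorem_of_calculus)
       (auto intro!: derivative_eq_intros simp: has_real_derivative_iff_has_vector_derivative[symmetric])
  moreover have "set_integrable lborel {0..1} (\<lambda>t. cos (2 * pi * t))"
    by (rule borel_integrable_atLeastAtMost') (intro continuous_intros)
  then have "(LBINT t:{0..1}. cos (2 * pi * t)) = integral {0..1} (\<lambda>t. cos (2 * pi * t))"
    by (rule set_borel_integral_eq_integral)
  ultimately show ?thesis
    by (subst integral_restrict_space) (auto simp: set_lebesgue_integral_def dest: integral_unique)
qed

section \<open>Integrals of functions of one or two coordinates of a product\<close>

context
  fixes M :: "'a measure" and d :: nat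
  assumes prob: "prob_space M"
begin

interpretation prob_space M by (rule prob)

interpretation product_prob_space "\<lambda>_. M" "{..<d}"
  by unfold_locales

text \<open>The integrand is a product over all coordinates whose other factors are the constant 1,
  and each of these integrates to 1 over a probability space.\<close>

lemma component_integral:
  fixes g :: "'a \<Rightarrow> real"
  assumes "integrable M g" "i < d"
  shows "integrable (\<Pi>\<^sub>M j\<in>{..<d}. M) (\<lambda>x. g (x i))"
    and "(\<integral>x. g (x i) \<partial>(\<Pi>\<^sub>M j\<in>{..<d}. M)) = integral\<^sup>L M g"
proof -
  let ?f = "\<lambda>k. if k = i then g else (\<lambda>_. 1)"
  have int: "integrable M (?f k)" for k using assms by auto
  have "(\<Prod>k<d. ?f k (x k)) = g (x i)" for x
    using assms by (simp add: if_distrib[of "\<lambda>h. h _"] prod.If_cases cong: if_cong)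
  moreover have "(\<Prod>k<d. integral\<^sup>L M (?f k)) = integral\<^sup>L M g"
    using assms by (simp add: if_distrib[of "integral\<^sup>L M"] prod.If_cases prob_space.prob_space[OF prob] cong: if_cong)
  ultimately show "integrable (\<Pi>\<^sub>M j\<in>{..<d}. M) (\<lambda>x. g (x i))"
    "(\<integral>x. g (x i) \<partial>(\<Pi>\<^sub>M j\<in>{..<d}. M)) = integral\<^sup>L M g"
    using product_integrable_prod[of "{..<d}" ?f] product_integral_prod[of "{..<d}" ?f] int
    by auto
qed

lemma component_product_integral:
  fixes g h :: "'a \<Rightarrow> real"
  assumes "integrable M g" "integrable M h" "i < d" "j < d" "i \<noteq> j"
  shows "integrable (\<Pi>\<^sub>M j\<in>{..<d}. M) (\<lambda>x. g (x i) * h (x j))"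
    and "(\<integral>x. g (x i) * h (x j) \<partial>(\<Pi>\<^sub>M j\<in>{..<d}. M)) = integral\<^sup>L M g * integral\<^sup>L M h"
proof -
  let ?f = "\<lambda>k. if k = i then g else if k = j then h else (\<lambda>_. 1)"
  have int: "integrable M (?f k)" for k using assms by auto
  have split: "{..<d} = insert i (insert j ({..<d} - {i, j}))" using assms by auto
  have "(\<Prod>k\<in>{..<d} - {i, j}. ?f k (x k)) = 1" for x
    by (rule prod.neutral) auto
  then have "(\<Prod>k<d. ?f k (x k)) = g (x i) * h (x j)" for x
    by (subst split) (use assms in simp)
  moreover have "(\<Prod>k\<in>{..<d} - {i, j}. integral\<^sup>L M (?f k)) = 1"
    by (rule prod.neutral) (auto simp: prob_space.prob_space[OF prob])
  then have "(\<Prod>k<d. integral\<^sup>L M (?f k)) = integral\<^sup>L M g * integral\<^sup>L M h"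
    by (subst split) (use assms in simp)
  ultimately show "integrable (\<Pi>\<^sub>M j\<in>{..<d}. M) (\<lambda>x. g (x i) * h (x j))"
    "(\<integral>x. g (x i) * h (x j) \<partial>(\<Pi>\<^sub>M j\<in>{..<d}. M)) = integral\<^sup>L M g * integral\<^sup>L M h"
    using product_integrable_prod[of "{..<d}" ?f] product_integral_prod[of "{..<d}" ?f] int
    by auto
qed

end

section \<open>First and second moments of the cosine mean\<close>

abbreviation cube :: "nat \<Rightarrow> (nat \<Rightarrow> real) measure" where
  "cube d \<equiv> \<Pi>\<^sub>M j\<in>{..<d}. unit_lborel"

lemma integrable_cos_powers:
  "integrable unit_lborel (\<lambda>t. cos (2 * pi * t) ^ n)"
proof -
  interpret prob_space unit_lborel by (rule prob_space_unit_lborel)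
  show ?thesis
    by (rule integrable_const_bound[of _ 1])
       (auto simp: power_le_one abs_cos_le_one power_abs intro!: measurable_restrict_space1)
qed

lemma cos_mean_integral:
  "integrable (cube d) (cos_mean d)" "(\<integral>\<theta>. cos_mean d \<theta> \<partial>cube d) = 0"
proof -
  note c = component_integral[OF prob_space_unit_lborel integrable_cos_powers[of 1, simplified]]
  show "integrable (cube d) (cos_mean d)"
    unfolding cos_mean_def by (auto intro!: c(1))
  show "(\<integral>\<theta>. cos_mean d \<theta> \<partial>cube d) = 0"
    unfolding cos_mean_def by (simp add: c integral_cos_2pi)
qed

lemma cos_mean_squared_integral:
  "integrable (cube d) (\<lambda>\<theta>. (cos_mean d \<theta>)\<^sup>2)"
  "(\<integral>\<theta>. (cos_mean d \<theta>)\<^sup>2 \<partial>cube d) \<le> 1 / real d"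
proof -
  interpret prob_space unit_lborel by (rule prob_space_unit_lborel)
  note c = integrable_cos_powers[of 1, simplified]
  note s = component_integral[OF prob_space_unit_lborel integrable_cos_powers[of 2]]
  note p = component_product_integral[OF prob_space_unit_lborel c c]
  have eq: "(cos_mean d \<theta>)\<^sup>2 =
      (\<Sum>i<d. \<Sum>j<d. cos (2 * pi * \<theta> i) * cos (2 * pi * \<theta> j)) / (real d)\<^sup>2" for \<theta>
    by (simp add: cos_mean_def power_divide power2_eq_square sum_product)
  have int: "integrable (cube d) (\<lambda>\<theta>. cos (2 * pi * \<theta> i) * cos (2 * pi * \<theta> j))"
    if "i < d" "j < d" for i j
    using that p[of i d j] s[of i d] by (cases "i = j") (auto simp: power2_eq_square)
  \<comment> \<open>Distinct coordinates are independent with mean 0, so only the \<open>d\<close>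
    diagonal terms survive, each at most 1. Division by d^2 then gives the bound 1/d.\<close>
  have val: "(\<integral>\<theta>. cos (2 * pi * \<theta> i) * cos (2 * pi * \<theta> j) \<partial>cube d) \<le> (if j = i then 1 else 0)"
    if "i < d" "j < d" for i j
  proof (cases "i = j")
    case True
    have "(\<integral>t. (cos (2 * pi * t))\<^sup>2 \<partial>unit_lborel) \<le> (\<integral>t. 1 \<partial>unit_lborel)"
      by (intro integral_mono integrable_cos_powers) (auto simp: abs_square_le_1)
    also have "\<dots> = 1"
      using prob_space by simp
    finally show ?thesis using True that s[of i d] by (auto simp: power2_eq_square)
  next
    case False
    then show ?thesis using that p[of i d j] by (simp add: integral_cos_2pi)
  qed
  show "integrable (cube d) (\<lambda>\<theta>. (cos_mean d \<theta>)\<^sup>2)"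
    unfolding eq by (intro integrable_divide Bochner_Integration.integrable_sum int) auto
  have "(\<integral>\<theta>. (\<Sum>i<d. \<Sum>j<d. cos (2 * pi * \<theta> i) * cos (2 * pi * \<theta> j)) \<partial>cube d) =
      (\<Sum>i<d. \<integral>\<theta>. (\<Sum>j<d. cos (2 * pi * \<theta> i) * cos (2 * pi * \<theta> j)) \<partial>cube d)"
    by (intro Bochner_Integration.integral_sum Bochner_Integration.integrable_sum int) auto
  also have "\<dots> = (\<Sum>i<d. \<Sum>j<d. \<integral>\<theta>. cos (2 * pi * \<theta> i) * cos (2 * pi * \<theta> j) \<partial>cube d)"
    by (intro sum.cong refl Bochner_Integration.integral_sum int) auto
  finally have "(\<integral>\<theta>. (cos_mean d \<theta>)\<^sup>2 \<partial>cube d) =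
      (\<Sum>i<d. \<Sum>j<d. \<integral>\<theta>. cos (2 * pi * \<theta> i) * cos (2 * pi * \<theta> j) \<partial>cube d) / (real d)\<^sup>2"
    unfolding eq by simp
  also have "\<dots> \<le> (\<Sum>i<d. \<Sum>j<d. if j = i then 1 else 0) / (real d)\<^sup>2"
    by (intro divide_right_mono sum_mono val) auto
  also have "\<dots> = 1 / real d"
    by (simp add: power2_eq_square)
  finally show "(\<integral>\<theta>. (cos_mean d \<theta>)\<^sup>2 \<partial>cube d) \<le> 1 / real d" .
qed

section \<open>Pointwise bounds for the logarithm\<close>

text \<open>Jensen's inequality via the tangent of \<open>ln\<close> at the mean \<open>m\<close>:
  the linear terms cancel because the deviations from \<open>m\<close> sum to 0.\<close>

lemma neg_ln_mean_le_mean_neg_ln: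
  fixes y :: "'a \<Rightarrow> real"
  assumes "finite I" "I \<noteq> {}" "\<And>i. i \<in> I \<Longrightarrow> 0 < y i"
  shows "- ln ((\<Sum>i\<in>I. y i) / card I) \<le> (\<Sum>i\<in>I. - ln (y i)) / card I"
proof -
  define m where "m = (\<Sum>i\<in>I. y i) / card I"
  have c: "real (card I) > 0" using assms by (simp add: card_gt_0_iff)
  have m: "m > 0" unfolding m_def using assms c by (intro divide_pos_pos sum_pos) auto
  have "(\<Sum>i\<in>I. ln (y i) - ln m) \<le> (\<Sum>i\<in>I. (y i - m) / m)"
    by (intro sum_mono ln_diff_le assms m)
  also have "\<dots> = ((\<Sum>i\<in>I. y i) - card I * m) / m"
    by (simp add: sum_subtractf flip: sum_divide_distrib)
  also have "\<dots> = 0" using c by (simp add: m_def)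
  finally show ?thesis
    using c unfolding m_def[symmetric] by (simp add: sum_subtractf sum_negf field_simps)
qed

text \<open>
  The excess of \<open>- ln (1 - x)\<close> over its tangent \<open>x\<close> is quadratic except near \<open>x = 1\<close>. There
  \<open>1 \<le> 4 * x\<^sup>2\<close>, and the arithmetic-geometric mean inequality trades a small multiple of the square of
  the logarithm for a large multiple of \<open>x\<^sup>2\<close>.
\<close>
lemma neg_ln_one_minus_excess_le:
  fixes x t :: real
  assumes "x < 1" "0 < t"
  shows "- ln (1 - x) - x \<le> (2 + 2 * t) * x\<^sup>2 + (if x > 1 / 2 then (ln (1 - x))\<^sup>2 / (2 * t) else 0)"
proof -
  consider "x < - 1 / 2" | "\<bar>x\<bar> \<le> 1 / 2" | "x > 1 / 2" by linarith
  then show ?thesis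
  proof cases
    case 1
    then have "0 \<le> ln (1 - x)" by simp
    \<comment> \<open>Here the logarithm is nonnegative, so only the term \<open>- x\<close> has to
      be absorbed, and it is at most twice its square.\<close>
    moreover have "(1 / 2) * (- x) \<le> (- x) * (- x)" using 1 by (intro mult_right_mono) auto
    moreover have "0 \<le> t * x\<^sup>2" using assms by simp
    moreover have "(2 + 2 * t) * x\<^sup>2 = 2 * ((- x) * (- x)) + 2 * (t * x\<^sup>2)"
      by (simp add: power2_eq_square algebra_simps)
    ultimately show ?thesis using 1 by argo
  next
    case 2
    then have "\<bar>ln (1 + - x) - - x\<bar> \<le> 2 * (- x)\<^sup>2"
      by (intro abs_ln_one_plus_x_minus_x_bound) auto
    moreover have "0 \<le> t * x\<^sup>2" using assms by simp
    moreover have "(2 + 2 * t) * x\<^sup>2 = 2 * (- x)\<^sup>2 + 2 * (t * x\<^sup>2)"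
      by (simp add: algebra_simps)
    moreover have "\<not> x > 1 / 2" using 2 by linarith
    ultimately show ?thesis by simp
  next
    case 3
    define L where "L = - ln (1 - x)"
    have "0 \<le> (L - t)\<^sup>2 / (2 * t)" using assms by simp
    also have "\<dots> = L\<^sup>2 / (2 * t) - L + t / 2"
      using assms by (simp add: power2_eq_square field_simps)
    finally have "L \<le> L\<^sup>2 / (2 * t) + t / 2" by simp
    moreover have "(1 / 2)\<^sup>2 \<le> x\<^sup>2" using 3 by (intro power_mono) auto
    then have "t * (1 / 4) \<le> t * x\<^sup>2" using assms by (intro mult_left_mono) (auto simp: power_divide)
    moreover have "(2 + 2 * t) * x\<^sup>2 = 2 * x\<^sup>2 + 2 * (t * x\<^sup>2)"
      by (simp add: algebra_simps)
    moreover have "0 \<le> x\<^sup>2" by simp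
    ultimately have "L - x \<le> (2 + 2 * t) * x\<^sup>2 + L\<^sup>2 / (2 * t)" using 3 by linarith
    then show ?thesis using 3 by (simp add: L_def)
  qed
qed

lemma neg_ln_one_minus_cos_mean_excess_le:
  assumes "d \<ge> 1" "0 < t" and \<theta>: "\<And>i. i < d \<Longrightarrow> 0 < \<theta> i \<and> \<theta> i < 1"
  shows "cos_mean d \<theta> < 1"
    and "- ln (1 - cos_mean d \<theta>) - cos_mean d \<theta> \<le> (2 + 2 * t) * (cos_mean d \<theta>)\<^sup>2 +
      (\<Sum>i<d. (ln (1 - cos (2 * pi * \<theta> i)))\<^sup>2) / real d / (2 * t)"
proof -
  let ?X = "cos_mean d \<theta>" and ?y = "\<lambda>i. 1 - cos (2 * pi * \<theta> i)"
  have y: "0 < ?y i" if "i < d" for i using cos_2pi_less_1 \<theta>[OF that] by simp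
  have mean: "1 - ?X = (\<Sum>i<d. ?y i) / real d"
    using assms by (simp add: cos_mean_def sum_subtractf field_simps)
  have "0 < (\<Sum>i<d. ?y i)" using y assms by (intro sum_pos) (auto simp: lessThan_empty_iff)
  then have "0 < (\<Sum>i<d. ?y i) / real d" using assms by simp
  then show X: "?X < 1" using mean by linarith
  have "(if ?X > 1 / 2 then (ln (1 - ?X))\<^sup>2 else 0) \<le> (\<Sum>i<d. (ln (?y i))\<^sup>2) / real d"
  proof (cases "?X > 1 / 2")
    case True
    have "- ln (1 - ?X) \<le> (\<Sum>i<d. - ln (?y i)) / real d"
      unfolding mean using neg_ln_mean_le_mean_neg_ln[of "{..<d}" ?y] y assms
      by (auto simp: lessThan_empty_iff)
    \<comment> \<open>Squaring preserves the inequality because \<open>?X > 1 / 2\<close> makes the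
      left side nonnegative.\<close>
    then have "(- ln (1 - ?X))\<^sup>2 \<le> ((\<Sum>i<d. - ln (?y i)) / real d)\<^sup>2"
      using True X by (intro power_mono) auto
    \<comment> \<open>Cauchy-Schwarz moves the square inside the mean.\<close>
    also have "\<dots> \<le> (\<Sum>i<d. (- ln (?y i))\<^sup>2) * real d / (real d)\<^sup>2"
      unfolding power_divide
      using sum_squared_le_sum_of_squares[of "\<lambda>i. - ln (?y i)" "{..<d}"]
      by (intro divide_right_mono) auto
    finally show ?thesis using True assms by (simp add: power2_eq_square)
  qed (auto intro!: divide_nonneg_nonneg sum_nonneg)
  then have "(if ?X > 1 / 2 then (ln (1 - ?X))\<^sup>2 else 0) / (2 * t) \<le>
      (\<Sum>i<d. (ln (?y i))\<^sup>2) / real d / (2 * t)"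
    using assms by (intro divide_right_mono) auto
  then show "- ln (1 - ?X) - ?X \<le> (2 + 2 * t) * ?X\<^sup>2 +
      (\<Sum>i<d. (ln (?y i))\<^sup>2) / real d / (2 * t)"
    using neg_ln_one_minus_excess_le[OF X \<open>0 < t\<close>] by (auto split: if_splits)
qed

section \<open>Bounds on the Mahler measure and the limit\<close>

text \<open>Since the cosine mean integrates to 0, \<mu> is minus the integral of the excess
  \<open>h\<close>. Almost everywhere 0 \<le> h \<le> B, which gives both bounds; \<open>t\<close>
  is left free for later balancing.\<close>

lemma mahler_measure_grid_laplacian_bounds:
  fixes t :: real
  assumes d: "d \<ge> 1" and t: "0 < t"
  defines "\<mu> \<equiv> mahler_measure d (grid_laplacian d) - ln (2 * real d)"
  shows "\<mu> \<le> 0"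
    and "- ((2 + 2 * t) / real d + (\<integral>s. (ln (1 - cos (2 * pi * s)))\<^sup>2 \<partial>unit_lborel) / (2 * t)) \<le> \<mu>"
proof -
  interpret prob_space "cube d"
    by (rule prob_space_PiM) (rule prob_space_unit_lborel)
  let ?K = "\<integral>s. (ln (1 - cos (2 * pi * s)))\<^sup>2 \<partial>unit_lborel"
  define h where "h \<theta> = - ln (1 - cos_mean d \<theta>) - cos_mean d \<theta>" for \<theta>
  define B where "B \<theta> = (2 + 2 * t) * (cos_mean d \<theta>)\<^sup>2 +
      (\<Sum>i<d. (ln (1 - cos (2 * pi * \<theta> i)))\<^sup>2) / real d / (2 * t)" for \<theta>
  note sq = component_integral[OF prob_space_unit_lborel integrable_ln_one_minus_cos_squared]
  note X = cos_mean_integral[of d] and X2 = cos_mean_squared_integral[of d]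
  have meas: "cos_mean d \<in> borel_measurable (cube d)"
    using X(1) by (rule borel_measurable_integrable)
  \<comment> \<open>Off this null set every 1 - cos is positive, so the convention for
    \<open>ln 0\<close> never enters.\<close>
  have "AE \<theta> in cube d. \<forall>i\<in>{..<d}. 0 < \<theta> i \<and> \<theta> i < 1"
    by (intro AE_finite_allI AE_PiM_component prob_space_unit_lborel AE_unit_lborel_interior) auto
  then have bounds: "AE \<theta> in cube d. cos_mean d \<theta> < 1 \<and> 0 \<le> h \<theta> \<and> h \<theta> \<le> B \<theta>"
  proof eventually_elim
    case (elim \<theta>)
    note b = neg_ln_one_minus_cos_mean_excess_le[OF d t, of \<theta>]
    have "cos_mean d \<theta> < 1" using b(1) elim by auto
    moreover from this have "0 \<le> h \<theta>"
      unfolding h_def using ln_le_minus_one[of "1 - cos_mean d \<theta>"] by simp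
    moreover have "h \<theta> \<le> B \<theta>" unfolding h_def B_def using b(2) elim by auto
    ultimately show ?case by simp
  qed
  have intX2: "integrable (cube d) (\<lambda>\<theta>. (2 + 2 * t) * (cos_mean d \<theta>)\<^sup>2)"
    using X2(1) by (rule integrable_mult_right)
  have intsum: "integrable (cube d)
      (\<lambda>\<theta>. (\<Sum>i<d. (ln (1 - cos (2 * pi * \<theta> i)))\<^sup>2) / real d / (2 * t))"
    by (intro integrable_divide Bochner_Integration.integrable_sum sq(1)) auto
  have intB: "integrable (cube d) B"
    unfolding B_def using intX2 intsum by (rule Bochner_Integration.integrable_add)
  have "(\<integral>\<theta>. B \<theta> \<partial>cube d) = (2 + 2 * t) * (\<integral>\<theta>. (cos_mean d \<theta>)\<^sup>2 \<partial>cube d) +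
      (\<Sum>i<d. ?K) / real d / (2 * t)"
    unfolding B_def Bochner_Integration.integral_add[OF intX2 intsum] by (simp add: sq)
  also have "\<dots> \<le> (2 + 2 * t) * (1 / real d) + (\<Sum>i<d. ?K) / real d / (2 * t)"
    using X2(2) t by (intro add_right_mono mult_left_mono) auto
  finally have B: "(\<integral>\<theta>. B \<theta> \<partial>cube d) \<le> (2 + 2 * t) / real d + ?K / (2 * t)"
    using d by simp
  \<comment> \<open>Domination by \<open>B\<close> yields integrability of the logarithm itself, so
    the integral can be split below.\<close>
  have inth: "integrable (cube d) h"
  proof (rule Bochner_Integration.integrable_bound[OF intB])
    show "h \<in> borel_measurable (cube d)" unfolding h_def using meas by measurable
    show "AE \<theta> in cube d. norm (h \<theta>) \<le> norm (B \<theta>)"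
      using bounds by eventually_elim auto
  qed
  have "mahler_measure d (grid_laplacian d) = (\<integral>\<theta>. ln (2 * real d * (1 - cos_mean d \<theta>)) \<partial>cube d)"
    unfolding mahler_measure_def cmod_laurent_eval_grid_laplacian[OF d] ..
  also have "\<dots> = (\<integral>\<theta>. ln (2 * real d) - cos_mean d \<theta> - h \<theta> \<partial>cube d)"
  proof (rule integral_cong_AE)
    show "AE \<theta> in cube d. ln (2 * real d * (1 - cos_mean d \<theta>)) = ln (2 * real d) - cos_mean d \<theta> - h \<theta>"
      using bounds by eventually_elim (use d in \<open>auto simp: h_def ln_mult\<close>)
  qed (use meas inth in measurable)
  also have "\<dots> = ln (2 * real d) - (\<integral>\<theta>. h \<theta> \<partial>cube d)"
    using X inth by (simp add: prob_space)
  finally have \<mu>: "\<mu> = - (\<integral>\<theta>. h \<theta> \<partial>cube d)" unfolding \<mu>_def by simp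
  have "0 \<le> (\<integral>\<theta>. h \<theta> \<partial>cube d)"
    by (rule integral_nonneg_AE) (use bounds in eventually_elim, auto)
  then show "\<mu> \<le> 0" unfolding \<mu> by simp
  have "(\<integral>\<theta>. h \<theta> \<partial>cube d) \<le> (\<integral>\<theta>. B \<theta> \<partial>cube d)"
    by (rule integral_mono_AE[OF inth intB]) (use bounds in eventually_elim, auto)
  then show "- ((2 + 2 * t) / real d + ?K / (2 * t)) \<le> \<mu>"
    unfolding \<mu> using B by simp
qed

theorem theorem3p15:
  "(\<forall>d\<ge>1. mahler_measure d (grid_laplacian d) \<le> ln (2 * real d)) \<and>
   (\<lambda>d. mahler_measure d (grid_laplacian d) - ln (2 * real d)) \<longlonglongrightarrow> 0"
proof
  show "\<forall>d\<ge>1. mahler_measure d (grid_laplacian d) \<le> ln (2 * real d)"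
    using mahler_measure_grid_laplacian_bounds(1)[of _ 1] by simp
  define K where "K = (\<integral>s. (ln (1 - cos (2 * pi * s)))\<^sup>2 \<partial>unit_lborel)"
  show "(\<lambda>d. mahler_measure d (grid_laplacian d) - ln (2 * real d)) \<longlonglongrightarrow> 0"
  proof (rule tendsto_sandwich)
    \<comment> \<open>The choice t = sqrt d makes 2t/d and K/(2t) both of order 1/sqrt d;
      \<open>K\<close> does not depend on \<open>d\<close>.\<close>
    show "\<forall>\<^sub>F d in sequentially. - ((2 + 2 * sqrt (real d)) / real d + K / (2 * sqrt (real d))) \<le>
        mahler_measure d (grid_laplacian d) - ln (2 * real d)"
      using eventually_ge_at_top[of 1]
      by eventually_elim
        (use mahler_measure_grid_laplacian_bounds(2) in \<open>auto simp: K_def\<close>)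
    show "\<forall>\<^sub>F d in sequentially. mahler_measure d (grid_laplacian d) - ln (2 * real d) \<le> 0"
      using eventually_ge_at_top[of 1]
      by eventually_elim (use mahler_measure_grid_laplacian_bounds(1)[of _ 1] in auto)
    show "(\<lambda>d. - ((2 + 2 * sqrt (real d)) / real d + K / (2 * sqrt (real d)))) \<longlonglongrightarrow> 0"
      by real_asymp
  qed simp
qed

end
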